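(* Let $\alpha>0$, $\rho>0$ and $0\le a<b$. Let $f:[a^\rho,b^\rho]\to\mathbb{R}$ be a differentiable mapping on $(a^\rho,b^\rho)$, with one-sided derivatives $f'(a^\rho)$, $f'(b^\rho)$ at the endpoints. If $|f'|$ is convex on $[a^\rho,b^\rho]$, then $$ \left|\frac{f(a^\rho)+f(b^\rho)}{2} - \frac{\rho^\alpha \Gamma(\alpha+1)}{2(b^\rho-a^\rho)^\alpha}\left[ {}^\rho I^\alpha_{a+}f(b^{\rho})+ {}^\rho I^\alpha_{b-}f(a^{\rho})\right] \right| \leq \frac{b^\rho - a^\rho}{2(\alpha+1)}\left[|f'(a^\rho)|+|f'(b^\rho)|\right]. $$
   Context: The left- and right-sided Katugampola fractional integrals of order $\alpha>0$ with parameter $\rho>0$ of a function $h$ on $[a,b]$ are $$ {}^\rho I^\alpha_{a+}h(x)=\frac{\rho^{1-\alpha}}{\Gamma(\alpha)}\int_a^x\frac{t^{\rho-1}}{(x^\rho-t^\rho)^{1-\alpha}}h(t)\,dt,\qquad {}^\rho I^\alpha_{b-}h(x)=\frac{\rho^{1-\alpha}}{\Gamma(\alpha)}\int_x^b\frac{t^{\rho-1}}{(t^\rho-x^\rho)^{1-\alpha}}h(t)\,dt,$$ when the integrals exist. For $f$ defined on $[a^\rho,b^\rho]$, the notation ${}^\rho I^\alpha_{a+}f(b^\rho)$ means the left-sided integral of the function $h(x)=f(x^\rho)$ on $[a,b]$ evaluated at $x=b$, i.e. $\frac{\rho^{1-\alpha}}{\Gamma(\alpha)}\int_a^b\frac{t^{\rho-1}}{(b^\rho-t^\rho)^{1-\alpha}}f(t^\rho)\,dt$,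 and ${}^\rho I^\alpha_{b-}f(a^\rho)$ means the right-sided integral of the same function evaluated at $x=a$, i.e. $\frac{\rho^{1-\alpha}}{\Gamma(\alpha)}\int_a^b\frac{t^{\rho-1}}{(t^\rho-a^\rho)^{1-\alpha}}f(t^\rho)\,dt$. $\Gamma$ is Euler's gamma function. *)

theory Defs
  imports "HOL-Analysis.Analysis"
begin

text \<open>
  Integrals are the library's gauge integrals, which agree with Lebesgue integrals on
  absolutely integrable functions. Where the kernel is singular (one end point, and possibly
  \<open>t = 0\<close>) the totalised values of \<open>powr\<close> and division are used; these points form a null set.
\<close>

definition katugampola_left :: "real \<Rightarrow> real \<Rightarrow> real \<Rightarrow> (real \<Rightarrow> real) \<Rightarrow> real \<Rightarrow> real" where
  "katugampola_left \<rho> \<alpha> a h x =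
     \<rho> powr (1 - \<alpha>) / Gamma \<alpha> *
     integral {a..x} (\<lambda>t. t powr (\<rho> - 1) / (x powr \<rho> - t powr \<rho>) powr (1 - \<alpha>) * h t)"

definition katugampola_right :: "real \<Rightarrow> real \<Rightarrow> real \<Rightarrow> (real \<Rightarrow> real) \<Rightarrow> real \<Rightarrow> real" where
  "katugampola_right \<rho> \<alpha> b h x =
     \<rho> powr (1 - \<alpha>) / Gamma \<alpha> *
     integral {x..b} (\<lambda>t. t powr (\<rho> - 1) / (t powr \<rho> - x powr \<rho>) powr (1 - \<alpha>) * h t)"

end

theory Submission
  imports Defs
begin

text \<open>
  Integrating \<open>f'\<close> by parts is avoided. Convexity bounds \<open>\<bar>f'\<bar>\<close> by its chord, so \<open>f\<close> deviates
  from its value at an end point by at most an explicit quadratic. With \<open>u = t powr \<rho>\<close>, both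
  kernels are \<open>v powr (\<alpha> - 1)\<close> for the distance \<open>v\<close> of \<open>u\<close> to one end of the interval.
  Integrating the quadratic that vanishes at the opposite end against this kernel gives one
  bound for each operator, and the two bounds add up to the claim.
\<close>

text \<open>The antiderivative is \<open>\<sigma> * \<Phi> (v t) / \<rho>\<close>. The sign
  \<open>\<sigma>\<close> says whether \<open>v\<close> falls or rises, so one computation serves
  both kernels. Differentiability is demanded in the interior, where \<open>v t\<close> and hence
  the kernel is regular; at the ends continuity suffices.\<close>

lemma kernel_has_integral:
  fixes v \<Phi> \<phi> :: "real \<Rightarrow> real"
  assumes "0 < \<rho>" "a < b"
    and cv: "continuous_on {a..b} v" and v0: "\<And>t. t \<in> {a..b} \<Longrightarrow> 0 \<le> v t"
    and vpos: "\<And>t. t \<in> {a<..<b} \<Longrightarrow> 0 < v t"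
    and dv: "\<And>t. t \<in> {a<..<b} \<Longrightarrow> (v has_real_derivative \<sigma> * (\<rho> * t powr (\<rho> - 1))) (at t)"
    and ends: "\<sigma> = -1 \<and> v a = L \<and> v b = 0 \<or> \<sigma> = 1 \<and> v a = 0 \<and> v b = L"
    and c\<Phi>: "continuous_on {0..} \<Phi>"
    and d\<Phi>: "\<And>x. 0 < x \<Longrightarrow> (\<Phi> has_real_derivative x powr (\<alpha> - 1) * \<phi> x) (at x)"
  shows "((\<lambda>t. t powr (\<rho> - 1) / v t powr (1 - \<alpha>) * \<phi> (v t)) has_integral (\<Phi> L - \<Phi> 0) / \<rho>) {a..b}"
proof -
  have "((\<lambda>t. t powr (\<rho> - 1) / v t powr (1 - \<alpha>) * \<phi> (v t))
      has_integral \<sigma> * \<Phi> (v b) / \<rho> - \<sigma> * \<Phi> (v a) / \<rho>) {a..b}"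
  proof (rule fundamental_theorem_of_calculus_interior)
    show "continuous_on {a..b} (\<lambda>t. \<sigma> * \<Phi> (v t) / \<rho>)"
      using v0 \<open>0 < \<rho>\<close> by (intro continuous_intros continuous_on_compose2[OF c\<Phi> cv]) auto
    fix t assume t: "t \<in> {a<..<b}"
    have "((\<lambda>t. \<Phi> (v t)) has_real_derivative
        v t powr (\<alpha> - 1) * \<phi> (v t) * (\<sigma> * (\<rho> * t powr (\<rho> - 1)))) (at t)"
      by (rule DERIV_chain2[OF d\<Phi>[OF vpos[OF t]] dv[OF t]])
    from DERIV_cmult[OF this, of "\<sigma> / \<rho>"]
    have "((\<lambda>t. \<sigma> * \<Phi> (v t) / \<rho>) has_real_derivative
        \<sigma> * \<sigma> * (v t powr (\<alpha> - 1) * \<phi> (v t) * t powr (\<rho> - 1))) (at t)"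
      using \<open>0 < \<rho>\<close> by (simp add: field_simps)
    moreover have "\<sigma> * \<sigma> = 1" using ends by auto
    moreover have "v t powr (\<alpha> - 1) = 1 / v t powr (1 - \<alpha>)"
      using powr_minus_divide[of "v t" "1 - \<alpha>"] by simp
    ultimately show "((\<lambda>t. \<sigma> * \<Phi> (v t) / \<rho>) has_vector_derivative
        t powr (\<rho> - 1) / v t powr (1 - \<alpha>) * \<phi> (v t)) (at t)"
      by (simp add: has_real_derivative_iff_has_vector_derivative[symmetric] mult_ac)
  qed (use \<open>a < b\<close> in auto)
  \<comment> \<open>For \<open>\<sigma> = -1\<close> the sign undoes the swapped boundary values, so
    both cases give the same number.\<close>
  moreover have "\<sigma> * \<Phi> (v b) / \<rho> - \<sigma> * \<Phi> (v a) / \<rho> = (\<Phi> L - \<Phi> 0) / \<rho>"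
    using ends by (auto simp: diff_divide_distrib)
  ultimately show ?thesis by simp
qed

text \<open>The left side is the absolute value of the integral of \<open>w t * (c - h t)\<close>,
  which \<open>w t * D t\<close> dominates pointwise.\<close>

lemma weighted_integral_deviation:
  fixes w h D :: "real \<Rightarrow> real"
  assumes w: "(w has_integral I) {a..b}" and wD: "((\<lambda>t. w t * D t) has_integral J) {a..b}"
    and w0: "\<And>t. t \<in> {a..b} \<Longrightarrow> 0 \<le> w t" and ch: "continuous_on {a..b} h"
    and dev: "\<And>t. t \<in> {a..b} \<Longrightarrow> \<bar>c - h t\<bar> \<le> D t"
  shows "\<bar>c * I - integral {a..b} (\<lambda>t. w t * h t)\<bar> \<le> J"
proof -
  \<comment> \<open>The weight may be unbounded near an end, so integrability of
    \<open>w t * h t\<close> comes from absolute integrability of \<open>w\<close> (by its sign) and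
    boundedness and measurability of \<open>h\<close>.\<close>
  have "w absolutely_integrable_on {a..b}"
    using w w0 by (intro nonnegative_absolutely_integrable_1) auto
  moreover have "bounded (h ` {a..b})"
    using ch compact_continuous_image compact_imp_bounded by blast
  moreover have "h \<in> borel_measurable (lebesgue_on {a..b})"
    by (rule continuous_imp_measurable_on_sets_lebesgue[OF ch]) auto
  ultimately have "(\<lambda>t. h t * w t) absolutely_integrable_on {a..b}"
    by (intro absolutely_integrable_bounded_measurable_product_real) auto
  then have "(\<lambda>t. w t * h t) integrable_on {a..b}"
    using set_lebesgue_integral_eq_integral(1) by (auto simp: mult.commute)
  then have "((\<lambda>t. c * w t - w t * h t) has_integral
      c * I - integral {a..b} (\<lambda>t. w t * h t)) {a..b}"
    by (intro has_integral_diff has_integral_mult_right w integrable_integral)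
  then have wh: "((\<lambda>t. w t * (c - h t)) has_integral
      c * I - integral {a..b} (\<lambda>t. w t * h t)) {a..b}"
    by (simp add: algebra_simps)
  have "\<bar>w t * (c - h t)\<bar> \<le> w t * D t" if "t \<in> {a..b}" for t
    using w0[OF that] dev[OF that] by (simp add: abs_mult mult_left_mono)
  then have "norm (integral {a..b} (\<lambda>t. w t * (c - h t))) \<le> integral {a..b} (\<lambda>t. w t * D t)"
    using wh wD by (intro integral_norm_bound_integral) (auto intro: has_integral_integrable)
  then show ?thesis
    using wh wD by (simp add: integral_unique)
qed

text \<open>The factor \<open>\<alpha> * \<rho> / L powr \<alpha>\<close> is the reciprocal of the
  kernel's total mass, so \<open>c\<close> is compared with a weighted mean of \<open>h\<close>. The
  bound is the same mean of the quadratic, a combination of the Beta integrals of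
  \<open>v powr (\<alpha> - 1)\<close> against \<open>L - v\<close> and its square.\<close>

lemma kernel_deviation:
  fixes v h :: "real \<Rightarrow> real"
  assumes "0 < \<alpha>" "0 < \<rho>" "a < b" "0 < L"
    and cv: "continuous_on {a..b} v" and v0: "\<And>t. t \<in> {a..b} \<Longrightarrow> 0 \<le> v t"
    and vpos: "\<And>t. t \<in> {a<..<b} \<Longrightarrow> 0 < v t"
    and dv: "\<And>t. t \<in> {a<..<b} \<Longrightarrow> (v has_real_derivative \<sigma> * (\<rho> * t powr (\<rho> - 1))) (at t)"
    and ends: "\<sigma> = -1 \<and> v a = L \<and> v b = 0 \<or> \<sigma> = 1 \<and> v a = 0 \<and> v b = L"
    and ch: "continuous_on {a..b} h"
    and dev: "\<And>t. t \<in> {a..b} \<Longrightarrow> \<bar>c - h t\<bar> \<le> r * (L - v t) + k * (L - v t)\<^sup>2 / 2"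
  shows "\<bar>c - \<alpha> * \<rho> / L powr \<alpha> *
      integral {a..b} (\<lambda>t. t powr (\<rho> - 1) / v t powr (1 - \<alpha>) * h t)\<bar>
    \<le> L / (\<alpha> + 1) * (r + k * L / (\<alpha> + 2))"
proof -
  define D where "D x = r * (L - x) + k * (L - x)\<^sup>2 / 2" for x
  \<comment> \<open>repeated integration by parts of \<open>x powr (\<alpha> - 1) * D x\<close>\<close>
  define \<Phi> where "\<Phi> x = x powr \<alpha> / \<alpha> * D x + x powr (\<alpha> + 1) / (\<alpha> * (\<alpha> + 1)) * (r + k * (L - x))
     + x powr (\<alpha> + 2) / (\<alpha> * (\<alpha> + 1) * (\<alpha> + 2)) * k" for x
  define w where "w t = t powr (\<rho> - 1) / v t powr (1 - \<alpha>)" for t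
  note ker = kernel_has_integral[OF \<open>0 < \<rho>\<close> \<open>a < b\<close> cv v0 vpos dv ends]
  \<comment> \<open>The total mass of the kernel: the constant case \<open>\<phi> = 1\<close>, with
    the factor kept so that \<open>ker\<close> unifies.\<close>
  have "((\<lambda>t. w t * 1) has_integral (L powr \<alpha> / \<alpha> - 0 powr \<alpha> / \<alpha>) / \<rho>) {a..b}"
    unfolding w_def
  proof (rule ker)
    show "continuous_on {0..} (\<lambda>x. x powr \<alpha> / \<alpha>)"
      using \<open>0 < \<alpha>\<close> by (intro continuous_intros continuous_on_powr') auto
    show "((\<lambda>x. x powr \<alpha> / \<alpha>) has_real_derivative x powr (\<alpha> - 1) * 1) (at x)" if "0 < x" for x
      using that \<open>0 < \<alpha>\<close> by (auto intro!: derivative_eq_intros)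
  qed
  then have w: "(w has_integral L powr \<alpha> / (\<alpha> * \<rho>)) {a..b}" by simp
  have "((\<lambda>t. w t * D (v t)) has_integral (\<Phi> L - \<Phi> 0) / \<rho>) {a..b}"
    unfolding w_def
  proof (rule ker)
    have powr: "continuous_on {0..} (\<lambda>x::real. x powr p)" if "0 < p" for p
      using that by (intro continuous_on_powr' continuous_intros) auto
    show "continuous_on {0..} \<Phi>"
      unfolding \<Phi>_def D_def
      using \<open>0 < \<alpha>\<close>
      by (intro continuous_on_add continuous_on_mult continuous_on_divide continuous_on_diff
          continuous_on_power continuous_on_const continuous_on_id powr) auto
    fix x :: real assume x: "0 < x"
    have powr: "((\<lambda>x. x powr p / p) has_real_derivative x powr (p - 1)) (at x)" if "0 < p" for p
      using x that by (auto intro!: derivative_eq_intros)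
    have D: "(D has_real_derivative - (r + k * (L - x))) (at x)"
      unfolding D_def by (auto intro!: derivative_eq_intros simp: field_simps)
    have K: "((\<lambda>x. r + k * (L - x)) has_real_derivative - k) (at x)"
      by (auto intro!: derivative_eq_intros)
    have p1: "((\<lambda>x. x powr (\<alpha> + 1) / (\<alpha> * (\<alpha> + 1))) has_real_derivative x powr \<alpha> / \<alpha>) (at x)"
      using DERIV_cdivide[OF powr[of "\<alpha> + 1"], of \<alpha>] \<open>0 < \<alpha>\<close> by (simp add: mult.commute)
    have p2: "((\<lambda>x. x powr (\<alpha> + 2) / (\<alpha> * (\<alpha> + 1) * (\<alpha> + 2))) has_real_derivative
        x powr (\<alpha> + 1) / (\<alpha> * (\<alpha> + 1))) (at x)"
      using DERIV_cdivide[OF powr[of "\<alpha> + 2"], of "\<alpha> * (\<alpha> + 1)"] \<open>0 < \<alpha>\<close>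
      by (simp add: mult_ac add.commute)
    show "(\<Phi> has_real_derivative x powr (\<alpha> - 1) * D x) (at x)"
      unfolding \<Phi>_def
      \<comment> \<open>The sum telescopes: differentiating the polynomial factor of one summand
        cancels against differentiating the power in the next.\<close>
      by (rule DERIV_cong[OF DERIV_add[OF DERIV_add[OF DERIV_mult[OF powr[OF \<open>0 < \<alpha>\<close>] D]
            DERIV_mult[OF p1 K]] DERIV_cmult_right[OF p2, of k]]]) (simp add: algebra_simps)
  qed
  moreover have "(\<Phi> L - \<Phi> 0) / \<rho> =
      L powr \<alpha> / (\<alpha> * \<rho>) * (L / (\<alpha> + 1) * (r + k * L / (\<alpha> + 2)))"
  proof -
    \<comment> \<open>At \<open>x = L\<close> both \<open>D x\<close> and \<open>L - x\<close>
      vanish; at \<open>x = 0\<close> every power does.\<close>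
    have "\<Phi> L = L powr \<alpha> * L / (\<alpha> * (\<alpha> + 1)) * r + L powr \<alpha> * L\<^sup>2 / (\<alpha> * (\<alpha> + 1) * (\<alpha> + 2)) * k"
      using \<open>0 < L\<close> by (simp add: \<Phi>_def D_def powr_add)
    moreover have "\<Phi> 0 = 0" by (simp add: \<Phi>_def)
    ultimately show ?thesis
      by (simp add: add_divide_distrib distrib_left power2_eq_square mult_ac)
  qed
  moreover define m where "m = L powr \<alpha> / (\<alpha> * \<rho>)"
  moreover define S where "S = integral {a..b} (\<lambda>t. w t * h t)"
  ultimately have "\<bar>c * m - S\<bar> \<le> m * (L / (\<alpha> + 1) * (r + k * L / (\<alpha> + 2)))"
    using dev unfolding m_def S_def
    by (intro weighted_integral_deviation[OF w _ _ ch, where D = "\<lambda>t. D (v t)"])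
      (auto simp: D_def w_def)
  moreover have "0 < m" using \<open>0 < \<alpha>\<close> \<open>0 < \<rho>\<close> \<open>0 < L\<close> by (simp add: m_def)
  ultimately have "\<bar>c * m - S\<bar> / m \<le> L / (\<alpha> + 1) * (r + k * L / (\<alpha> + 2))"
    by (metis pos_divide_le_eq mult.commute)
  moreover have "c - S / m = (c * m - S) / m"
    using \<open>0 < m\<close> by (simp add: field_simps)
  then have "\<bar>c * m - S\<bar> / m = \<bar>c - S / m\<bar>"
    using \<open>0 < m\<close> by (simp add: abs_divide)
  moreover have "S / m = \<alpha> * \<rho> / L powr \<alpha> * S" by (simp add: m_def)
  ultimately show ?thesis by (simp add: S_def w_def)
qed

theorem theorem2p3:
  fixes \<alpha> \<rho> a b :: real and f f' :: "real \<Rightarrow> real"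
  assumes "\<alpha> > 0" and "\<rho> > 0" and "0 \<le> a" and "a < b"
    and "\<And>x. x \<in> {a powr \<rho><..<b powr \<rho>} \<Longrightarrow> (f has_real_derivative f' x) (at x)"
    and "(f has_real_derivative f' (a powr \<rho>)) (at_right (a powr \<rho>))"
    and "(f has_real_derivative f' (b powr \<rho>)) (at_left (b powr \<rho>))"
    and "convex_on {a powr \<rho>..b powr \<rho>} (\<lambda>x. \<bar>f' x\<bar>)"
  shows "\<bar>(f (a powr \<rho>) + f (b powr \<rho>)) / 2
          - \<rho> powr \<alpha> * Gamma (\<alpha> + 1) / (2 * (b powr \<rho> - a powr \<rho>) powr \<alpha>)
            * (katugampola_left \<rho> \<alpha> a (\<lambda>x. f (x powr \<rho>)) b
               + katugampola_right \<rho> \<alpha> b (\<lambda>x. f (x powr \<rho>)) a)\<bar>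
        \<le> (b powr \<rho> - a powr \<rho>) / (2 * (\<alpha> + 1))
          * (\<bar>f' (a powr \<rho>)\<bar> + \<bar>f' (b powr \<rho>)\<bar>)"
proof -
  define A where "A = a powr \<rho>"
  define B where "B = b powr \<rho>"
  define L where "L = B - A"
  define p where "p = \<bar>f' A\<bar>"
  define q where "q = \<bar>f' B\<bar>"
  \<comment> \<open>The slope of the chord of \<open>\<bar>f' x\<bar>\<close> over
    \<open>{A..B}\<close>.\<close>
  define k where "k = (q - p) / L"
  have "A < B" unfolding A_def B_def using assms by (intro powr_less_mono2) auto
  then have "0 < L" by (simp add: L_def)
  have kL: "k * L = q - p" using \<open>0 < L\<close> by (simp add: k_def)
  have img: "t powr \<rho> \<in> {A..B}" if "t \<in> {a..b}" for t
    using that assms by (auto simp: A_def B_def intro!: powr_mono2)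
  have img': "t powr \<rho> \<in> {A<..<B}" if "t \<in> {a<..<b}" for t
    using that assms by (auto simp: A_def B_def intro!: powr_less_mono2)
  have df: "(f has_real_derivative f' x) (at x)" if "x \<in> {A<..<B}" for x
    using assms(5) that by (simp add: A_def B_def)
  \<comment> \<open>At the two ends continuity comes from the one-sided derivatives.\<close>
  have cf: "continuous_on {A..B} f"
  proof (unfold continuous_on_eq_continuous_within, rule ballI)
    fix x assume "x \<in> {A..B}"
    then consider "x = A" | "x = B" | "x \<in> {A<..<B}" by fastforce
    then show "continuous (at x within {A..B}) f"
    proof cases
      case 1
      then show ?thesis
        using assms(6) \<open>A < B\<close> DERIV_continuous by (auto simp: at_within_Icc_at_right A_def)
    next
      case 2
      then show ?thesis
        using assms(7) \<open>A < B\<close> DERIV_continuous by (auto simp: at_within_Icc_at_left B_def)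
    next
      case 3
      then show ?thesis
        using df DERIV_isCont continuous_at_imp_continuous_within by blast
    qed
  qed
  \<comment> \<open>The antiderivative, vanishing at \<open>A\<close>, of the chord
    \<open>p + k * (x - A)\<close>. Convexity puts \<open>\<bar>f' x\<bar>\<close> below that chord,
    so increments of \<open>Q\<close> bound those of \<open>f\<close>.\<close>
  define Q where "Q x = p * (x - A) + k * (x - A)\<^sup>2 / 2" for x
  have Q: "\<bar>f y - f x\<bar> \<le> Q y - Q x" if "A \<le> x" "x \<le> y" "y \<le> B" for x y
  proof (cases "x = y")
    case False
    have "norm (f y - f x) \<le> Q y - Q x"
    proof (rule differentiable_bound_general)
      show "x < y" using False that by simp
      show "continuous_on {x..y} f" using continuous_on_subset[OF cf] that by simp
      show "continuous_on {x..y} Q" unfolding Q_def by (intro continuous_intros) auto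
      fix z assume z: "x < z" "z < y"
      show "(f has_vector_derivative f' z) (at z)"
        using df[of z] z that by (simp add: has_real_derivative_iff_has_vector_derivative)
      have "(Q has_real_derivative p + k * (z - A)) (at z)"
        unfolding Q_def by (auto intro!: derivative_eq_intros simp: field_simps)
      then show "(Q has_vector_derivative p + k * (z - A)) (at z)"
        by (simp add: has_real_derivative_iff_has_vector_derivative)
      show "norm (f' z) \<le> p + k * (z - A)"
        using convex_onD_Icc'[OF assms(8), of z] z that
        by (simp add: k_def L_def p_def q_def A_def B_def add.commute)
    qed
    then show ?thesis by simp
  qed simp
  have cpow: "continuous_on {a..b} (\<lambda>t. t powr \<rho>)"
    using assms by (intro continuous_on_powr' continuous_intros) auto
  have ch: "continuous_on {a..b} (\<lambda>t. f (t powr \<rho>))"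
    by (rule continuous_on_compose2[OF cf cpow]) (use img in auto)
  define S where "S = integral {a..b} (\<lambda>t. t powr (\<rho> - 1) / (B - t powr \<rho>) powr (1 - \<alpha>) * f (t powr \<rho>))"
  define T where "T = integral {a..b} (\<lambda>t. t powr (\<rho> - 1) / (t powr \<rho> - A) powr (1 - \<alpha>) * f (t powr \<rho>))"
  \<comment> \<open>Interior points satisfy \<open>t > 0\<close> even if \<open>a = 0\<close>, where
    the power can fail to be differentiable.\<close>
  have dpow: "((\<lambda>t. t powr \<rho>) has_real_derivative \<rho> * t powr (\<rho> - 1)) (at t)"
    if "t \<in> {a<..<b}" for t
    using that assms(3) by (intro has_real_derivative_powr) auto
  \<comment> \<open>Here \<open>v t = B - t powr \<rho>\<close>, so \<open>L - v t\<close> is the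
    distance of \<open>t powr \<rho>\<close> from \<open>A\<close>, and the bound is
    \<open>Q\<close> itself.\<close>
  have left: "\<bar>f A - \<alpha> * \<rho> / L powr \<alpha> * S\<bar> \<le> L / (\<alpha> + 1) * (p + k * L / (\<alpha> + 2))"
    unfolding S_def
  proof (rule kernel_deviation[where \<sigma> = "-1"])
    show "\<bar>f A - f (t powr \<rho>)\<bar> \<le> p * (L - (B - t powr \<rho>)) + k * (L - (B - t powr \<rho>))\<^sup>2 / 2"
      if "t \<in> {a..b}" for t
      using Q[of A "t powr \<rho>"] img[OF that] by (simp add: Q_def L_def abs_minus_commute)
    show "((\<lambda>t. B - t powr \<rho>) has_real_derivative - 1 * (\<rho> * t powr (\<rho> - 1))) (at t)"
      if "t \<in> {a<..<b}" for t
      using DERIV_diff[OF DERIV_const dpow[OF that]] by simp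
  qed (use assms \<open>0 < L\<close> ch cpow img img' in
      \<open>auto intro!: continuous_intros simp: A_def B_def L_def\<close>)
  \<comment> \<open>The mirror image: seen from \<open>B\<close>, the chord starts at
    \<open>q\<close> and has slope \<open>- k\<close> in the distance from \<open>B\<close>.\<close>
  have right: "\<bar>f B - \<alpha> * \<rho> / L powr \<alpha> * T\<bar> \<le> L / (\<alpha> + 1) * (q + - k * L / (\<alpha> + 2))"
    unfolding T_def
  proof (rule kernel_deviation[where \<sigma> = 1])
    show "\<bar>f B - f (t powr \<rho>)\<bar> \<le> q * (L - (t powr \<rho> - A)) + - k * (L - (t powr \<rho> - A))\<^sup>2 / 2"
      if "t \<in> {a..b}" for t
    proof -
      \<comment> \<open>The value of the chord at \<open>B\<close>, needed to re-expand
        \<open>Q\<close> about that point.\<close>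
      have q: "q = p + k * (B - A)" using kL by (simp add: L_def)
      have "Q B - Q x = q * (B - x) + - k * (B - x)\<^sup>2 / 2" for x
        unfolding q by (simp add: Q_def power2_eq_square field_simps)
      then show ?thesis
        using Q[of "t powr \<rho>" B] img[OF that] by (simp add: L_def)
    qed
    show "((\<lambda>t. t powr \<rho> - A) has_real_derivative 1 * (\<rho> * t powr (\<rho> - 1))) (at t)"
      if "t \<in> {a<..<b}" for t
      using DERIV_diff[OF dpow[OF that] DERIV_const] by simp
  qed (use assms \<open>0 < L\<close> ch cpow img img' in
      \<open>auto intro!: continuous_intros simp: A_def B_def L_def\<close>)
  \<comment> \<open>By \<open>Gamma (\<alpha> + 1) = \<alpha> * Gamma \<alpha>\<close>, the outer
    factor and the operators' normalisation combine to the constant of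
    \<open>kernel_deviation\<close>.\<close>
  have const: "\<rho> powr \<alpha> * Gamma (\<alpha> + 1) * (\<rho> powr (1 - \<alpha>) / Gamma \<alpha>) = \<alpha> * \<rho>"
  proof -
    have "\<rho> powr \<alpha> * \<rho> powr (1 - \<alpha>) = \<rho>"
      using \<open>0 < \<rho>\<close> by (simp flip: powr_add)
    moreover have "\<alpha> \<notin> \<int>\<^sub>\<le>\<^sub>0" using \<open>0 < \<alpha>\<close> by (auto elim!: nonpos_Ints_cases)
    then have "Gamma (\<alpha> + 1) / Gamma \<alpha> = \<alpha>"
      using \<open>0 < \<alpha>\<close> by (simp add: Gamma_plus1 Gamma_eq_zero_iff)
    moreover have "x * y * (z / w) = y / w * (x * z)" for x y z w :: real by simp
    ultimately show ?thesis by metis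
  qed
  \<comment> \<open>Stated with letters so that the instance contains the left side of
    \<open>const\<close> literally.\<close>
  have "x / (2 * y) * (z * S + z * T) = (x * z / y * S + x * z / y * T) / 2" for x y z :: real
    by (simp add: add_divide_distrib distrib_left)
  from this[of "\<rho> powr \<alpha> * Gamma (\<alpha> + 1)" "L powr \<alpha>" "\<rho> powr (1 - \<alpha>) / Gamma \<alpha>", unfolded const]
  have "(f A + f B) / 2 - \<rho> powr \<alpha> * Gamma (\<alpha> + 1) / (2 * L powr \<alpha>)
        * (katugampola_left \<rho> \<alpha> a (\<lambda>x. f (x powr \<rho>)) b
           + katugampola_right \<rho> \<alpha> b (\<lambda>x. f (x powr \<rho>)) a)
      = ((f A - \<alpha> * \<rho> / L powr \<alpha> * S) + (f B - \<alpha> * \<rho> / L powr \<alpha> * T)) / 2"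
    unfolding katugampola_left_def katugampola_right_def S_def[symmetric] T_def[symmetric]
      A_def[symmetric] B_def[symmetric] by simp
  \<comment> \<open>The slope terms have opposite signs and cancel, leaving
    \<open>p + q\<close>.\<close>
  moreover have "L / (\<alpha> + 1) * (p + k * L / (\<alpha> + 2)) + L / (\<alpha> + 1) * (q + - k * L / (\<alpha> + 2))
      = 2 * (L / (2 * (\<alpha> + 1)) * (p + q))"
    using \<open>0 < \<alpha>\<close> by (simp add: divide_simps) (simp add: algebra_simps)
  moreover have average: "\<bar>x\<bar> \<le> y"
    if "x = (u + w) / 2" "\<bar>u\<bar> \<le> m" "\<bar>w\<bar> \<le> n" "m + n = 2 * y" for x y u w m n :: real
    using that unfolding abs_le_iff by simp
  ultimately show ?thesis
    using average[OF _ left right] unfolding p_def q_def L_def A_def B_def by blast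
qed

end
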